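(* Let $T$ be a consistent RE theory (in a language containing a constant $\mathbf{0}$ and a unary function symbol $\mathbf{S}$). If $T$ is RSS, then $T$ is RI.
   Context: $\overline{n}=\mathbf{S}^n\mathbf{0}$. $T$ is RSS if every recursive set $A\subseteq\mathbb{N}$ is strongly representable in $T$: there is a formula $\phi(x)$ with $n\in A\Rightarrow T\vdash\phi(\overline{n})$ and $n\notin A\Rightarrow T\vdash\neg\phi(\overline{n})$. With sentences identified with Gödel numbers, $T_P=\{\ulcorner\phi\urcorner:T\vdash\phi\}$, $T_R=\{\ulcorner\phi\urcorner:T\vdash\neg\phi\}$; $T$ is RI if there is no recursive set $X$ with $T_P\subseteq X$ and $X\cap T_R=\emptyset$. *)

theory Defs
  imports Main "HOL-Library.Nat_Bijection"
begin

section \<open>Recursive and recursively enumerable sets\<close>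

datatype recf =
    Zero
  | Succ
  | Proj nat
  | Comp recf "recf list"
  | PrimRec recf recf
  | Mu recf

text \<open>
  \<open>computes f xs y\<close>: the partial recursive function denoted by \<open>f\<close> is defined at \<open>xs\<close> with value
  \<open>y\<close>. In primitive recursion and minimisation the recursion (search) variable is the first
  argument; minimisation requires all values below the least zero to be defined.
\<close>

inductive computes :: "recf \<Rightarrow> nat list \<Rightarrow> nat \<Rightarrow> bool" where
  zero: "computes Zero xs 0"
| succ: "computes Succ [x] (Suc x)"
| proj: "i < length xs \<Longrightarrow> computes (Proj i) xs (xs ! i)"
| comp: "list_all2 (\<lambda>g y. computes g xs y) gs ys \<Longrightarrow> computes f ys v
    \<Longrightarrow> computes (Comp f gs) xs v"
| primrec_0: "computes f xs v \<Longrightarrow> computes (PrimRec f g) (0 # xs) v"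
| primrec_Suc: "computes (PrimRec f g) (n # xs) r \<Longrightarrow> computes g (n # r # xs) v
    \<Longrightarrow> computes (PrimRec f g) (Suc n # xs) v"
| mu: "computes f (n # xs) 0 \<Longrightarrow> (\<And>m. m < n \<Longrightarrow> \<exists>k. computes f (m # xs) (Suc k))
    \<Longrightarrow> computes (Mu f) xs n"

definition recursive_set :: "nat set \<Rightarrow> bool" where
  "recursive_set A \<longleftrightarrow> (\<exists>f. \<forall>n. computes f [n] (if n \<in> A then 1 else 0))"

definition re_set :: "nat set \<Rightarrow> bool" where
  "re_set A \<longleftrightarrow> (\<exists>f. \<forall>n. n \<in> A \<longleftrightarrow> (\<exists>y. computes f [n] y))"


section \<open>First-order logic with equality\<close>

text \<open>
  Symbols are named by natural numbers; a symbol is a pair of a name and an arity. A language is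
  an arbitrary set of function symbols together with an arbitrary set of relation symbols.
\<close>

record language =
  fun_syms :: "(nat \<times> nat) set"
  rel_syms :: "(nat \<times> nat) set"

datatype tm = Var nat | Fun nat "tm list"

datatype fm =
    Rel nat "tm list"
  | Eq tm tm
  | Neg fm
  | Imp fm fm
  | All nat fm

fun wf_tm :: "language \<Rightarrow> tm \<Rightarrow> bool" where
  "wf_tm L (Var x) \<longleftrightarrow> True"
| "wf_tm L (Fun f ts) \<longleftrightarrow> (f, length ts) \<in> fun_syms L \<and> (\<forall>t \<in> set ts. wf_tm L t)"

fun wf_fm :: "language \<Rightarrow> fm \<Rightarrow> bool" where
  "wf_fm L (Rel r ts) \<longleftrightarrow> (r, length ts) \<in> rel_syms L \<and> (\<forall>t \<in> set ts. wf_tm L t)"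
| "wf_fm L (Eq s t) \<longleftrightarrow> wf_tm L s \<and> wf_tm L t"
| "wf_fm L (Neg p) \<longleftrightarrow> wf_fm L p"
| "wf_fm L (Imp p q) \<longleftrightarrow> wf_fm L p \<and> wf_fm L q"
| "wf_fm L (All x p) \<longleftrightarrow> wf_fm L p"

fun fv_tm :: "tm \<Rightarrow> nat set" where
  "fv_tm (Var x) = {x}"
| "fv_tm (Fun f ts) = (\<Union>t \<in> set ts. fv_tm t)"

fun fv :: "fm \<Rightarrow> nat set" where
  "fv (Rel r ts) = (\<Union>t \<in> set ts. fv_tm t)"
| "fv (Eq s t) = fv_tm s \<union> fv_tm t"
| "fv (Neg p) = fv p"
| "fv (Imp p q) = fv p \<union> fv q"
| "fv (All x p) = fv p - {x}"

definition sentence :: "language \<Rightarrow> fm \<Rightarrow> bool" where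
  "sentence L p \<longleftrightarrow> wf_fm L p \<and> fv p = {}"

fun subst_tm :: "nat \<Rightarrow> tm \<Rightarrow> tm \<Rightarrow> tm" where
  "subst_tm x t (Var y) = (if y = x then t else Var y)"
| "subst_tm x t (Fun f ts) = Fun f (map (subst_tm x t) ts)"

text \<open>
  \<open>subst x t p\<close> replaces the free occurrences of \<open>x\<close> in \<open>p\<close> by \<open>t\<close> without renaming bound
  variables; \<open>free_for t x p\<close> says that no variable of \<open>t\<close> is captured. It always holds for
  closed \<open>t\<close>.
\<close>

fun subst :: "nat \<Rightarrow> tm \<Rightarrow> fm \<Rightarrow> fm" where
  "subst x t (Rel r ts) = Rel r (map (subst_tm x t) ts)"
| "subst x t (Eq u v) = Eq (subst_tm x t u) (subst_tm x t v)"
| "subst x t (Neg p) = Neg (subst x t p)"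
| "subst x t (Imp p q) = Imp (subst x t p) (subst x t q)"
| "subst x t (All y p) = (if y = x then All y p else All y (subst x t p))"

fun free_for :: "tm \<Rightarrow> nat \<Rightarrow> fm \<Rightarrow> bool" where
  "free_for t x (Rel r ts) \<longleftrightarrow> True"
| "free_for t x (Eq u v) \<longleftrightarrow> True"
| "free_for t x (Neg p) \<longleftrightarrow> free_for t x p"
| "free_for t x (Imp p q) \<longleftrightarrow> free_for t x p \<and> free_for t x q"
| "free_for t x (All y p) \<longleftrightarrow> x \<notin> fv (All y p) \<or> (y \<notin> fv_tm t \<and> free_for t x p)"

text \<open>
  Mendelson's Hilbert calculus for classical first-order logic with equality, restricted to
  formulas of \<open>L\<close>. Unrestricted generalisation is sound because the nonlogical axioms \<open>T\<close> are
  sentences.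
\<close>

inductive provable :: "language \<Rightarrow> fm set \<Rightarrow> fm \<Rightarrow> bool" for L :: language and T :: "fm set" where
  axiom: "p \<in> T \<Longrightarrow> provable L T p"
| imp_K: "wf_fm L p \<Longrightarrow> wf_fm L q \<Longrightarrow> provable L T (Imp p (Imp q p))"
| imp_S: "wf_fm L p \<Longrightarrow> wf_fm L q \<Longrightarrow> wf_fm L r \<Longrightarrow>
    provable L T (Imp (Imp p (Imp q r)) (Imp (Imp p q) (Imp p r)))"
| neg: "wf_fm L p \<Longrightarrow> wf_fm L q \<Longrightarrow>
    provable L T (Imp (Imp (Neg q) (Neg p)) (Imp (Imp (Neg q) p) q))"
| all_inst: "wf_fm L p \<Longrightarrow> wf_tm L t \<Longrightarrow> free_for t x p \<Longrightarrow>
    provable L T (Imp (All x p) (subst x t p))"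
| all_imp: "wf_fm L p \<Longrightarrow> wf_fm L q \<Longrightarrow> x \<notin> fv p \<Longrightarrow>
    provable L T (Imp (All x (Imp p q)) (Imp p (All x q)))"
| eq_refl: "wf_tm L t \<Longrightarrow> provable L T (Eq t t)"
| eq_subst: "wf_fm L p \<Longrightarrow> wf_tm L s \<Longrightarrow> wf_tm L t \<Longrightarrow> free_for s x p \<Longrightarrow> free_for t x p \<Longrightarrow>
    provable L T (Imp (Eq s t) (Imp (subst x s p) (subst x t p)))"
| mp: "provable L T (Imp p q) \<Longrightarrow> provable L T p \<Longrightarrow> provable L T q"
| gen: "provable L T p \<Longrightarrow> provable L T (All x p)"


section \<open>Goedel numbering\<close>

fun code_tm :: "tm \<Rightarrow> nat" where
  "code_tm (Var x) = prod_encode (0, x)"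
| "code_tm (Fun f ts) = prod_encode (1, prod_encode (f, list_encode (map code_tm ts)))"

fun code :: "fm \<Rightarrow> nat" where
  "code (Rel r ts) = prod_encode (0, prod_encode (r, list_encode (map code_tm ts)))"
| "code (Eq s t) = prod_encode (1, prod_encode (code_tm s, code_tm t))"
| "code (Neg p) = prod_encode (2, code p)"
| "code (Imp p q) = prod_encode (3, prod_encode (code p, code q))"
| "code (All x p) = prod_encode (4, prod_encode (x, code p))"

lemma code_tm_inject: "code_tm s = code_tm t \<longleftrightarrow> s = t"
proof (induction s arbitrary: t)
  case (Var x)
  then show ?case by (cases t) auto
next
  case (Fun f ts)
  have "map code_tm ts = map code_tm us \<Longrightarrow> ts = us" for us
    using Fun.IH by (auto simp: list_eq_iff_nth_eq)
  then show ?case by (cases t) (auto simp: list_encode_eq)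
qed

lemma code_inject: "code p = code q \<longleftrightarrow> p = q"
proof (induction p arbitrary: q)
  case (Rel r ts)
  have "inj code_tm" by (simp add: inj_def code_tm_inject)
  then show ?case by (cases q) (auto simp: inj_map_eq_map list_encode_eq)
next
  case (Eq s t)
  then show ?case by (cases q) (auto simp: code_tm_inject)
qed (case_tac q; auto)+


section \<open>Theories\<close>

definition is_theory :: "language \<Rightarrow> fm set \<Rightarrow> bool" where
  "is_theory L T \<longleftrightarrow> (\<forall>p \<in> T. sentence L p)"

definition re_theory :: "language \<Rightarrow> fm set \<Rightarrow> bool" where
  "re_theory L T \<longleftrightarrow> is_theory L T \<and> re_set (code ` T)"

definition consistent :: "language \<Rightarrow> fm set \<Rightarrow> bool" where
  "consistent L T \<longleftrightarrow> \<not> (\<exists>p. provable L T p \<and> provable L T (Neg p))"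

text \<open>In the following, \<open>z\<close> and \<open>s\<close> are the names of the constant and the unary function
  symbol from which the numerals are built.\<close>

fun numeral_tm :: "nat \<Rightarrow> nat \<Rightarrow> nat \<Rightarrow> tm" where
  "numeral_tm z s 0 = Fun z []"
| "numeral_tm z s (Suc n) = Fun s [numeral_tm z s n]"

definition strongly_representable ::
    "language \<Rightarrow> nat \<Rightarrow> nat \<Rightarrow> fm set \<Rightarrow> nat set \<Rightarrow> bool" where
  "strongly_representable L z s T A \<longleftrightarrow>
    (\<exists>x p. wf_fm L p \<and> fv p \<subseteq> {x} \<and>
      (\<forall>n. (n \<in> A \<longrightarrow> provable L T (subst x (numeral_tm z s n) p)) \<and>
           (n \<notin> A \<longrightarrow> provable L T (Neg (subst x (numeral_tm z s n) p)))))"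

definition RSS :: "language \<Rightarrow> nat \<Rightarrow> nat \<Rightarrow> fm set \<Rightarrow> bool" where
  "RSS L z s T \<longleftrightarrow> (\<forall>A. recursive_set A \<longrightarrow> strongly_representable L z s T A)"

definition provable_codes :: "language \<Rightarrow> fm set \<Rightarrow> nat set" where
  "provable_codes L T = {code p | p. sentence L p \<and> provable L T p}"

definition refutable_codes :: "language \<Rightarrow> fm set \<Rightarrow> nat set" where
  "refutable_codes L T = {code p | p. sentence L p \<and> provable L T (Neg p)}"

definition RI :: "language \<Rightarrow> fm set \<Rightarrow> bool" where
  "RI L T \<longleftrightarrow> \<not> (\<exists>X. recursive_set X \<and> provable_codes L T \<subseteq> X \<and> X \<inter> refutable_codes L T = {})"

end

theory Submission
  imports Defs
begin

text \<open>
  If a recursive set \<open>X\<close> separated the theorems from the refutable sentences, diagonalise: let \<open>D\<close>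
  be the set of codes of formulas \<open>p(x\<^sub>0)\<close> whose instance \<open>p(\<ulcorner>p\<urcorner>)\<close> lies outside \<open>X\<close>, and let \<open>p\<close>
  strongly represent \<open>D\<close>. Then \<open>p(\<ulcorner>p\<urcorner>)\<close> is provable or refutable, and either case contradicts the
  choice of \<open>X\<close>. To keep \<open>D\<close> visibly recursive, without arithmetising substitution or decoding
  pairs, the instance \<open>p(t)\<close> is replaced by the equivalent sentence \<open>\<forall>x (t = x \<longrightarrow> p)\<close>, and the
  same device changes the free variable of a representing formula to \<open>x\<^sub>0\<close>.
\<close>

section \<open>Recursiveness of the diagonal function\<close>

lemma computes_Comp1:
  assumes "computes g xs a" "computes f [a] v"
  shows "computes (Comp f [g]) xs v"
  using assms by (auto intro!: computes.comp[where ys = "[a]"])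

lemma computes_Comp2:
  assumes "computes g xs a" "computes h xs b" "computes f [a, b] v"
  shows "computes (Comp f [g, h]) xs v"
  using assms by (auto intro!: computes.comp[where ys = "[a, b]"])

lemma computes_Proj: "i < length xs \<Longrightarrow> v = xs ! i \<Longrightarrow> computes (Proj i) xs v"
  by (simp add: computes.proj)

text \<open>Like the later combinators, this acts pointwise on functions of a common argument list,
  so nested terms translate directly into \<open>recf\<close>.\<close>

definition succ_recf :: "recf \<Rightarrow> recf" where
  "succ_recf f = Comp Succ [f]"

lemma computes_succ_recf: "computes f xs a \<Longrightarrow> computes (succ_recf f) xs (Suc a)"
  unfolding succ_recf_def by (blast intro: computes_Comp1 computes.succ)

fun const_recf :: "nat \<Rightarrow> recf" where
  "const_recf 0 = Zero"
| "const_recf (Suc n) = succ_recf (const_recf n)"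

lemma computes_const_recf: "computes (const_recf n) xs n"
  by (induction n) (auto intro: computes.zero computes_succ_recf)

definition add_recf :: "recf \<Rightarrow> recf \<Rightarrow> recf" where
  "add_recf f g = Comp (PrimRec (Proj 0) (succ_recf (Proj 1))) [f, g]"

lemma computes_add_recf:
  assumes "computes f xs a" "computes g xs b"
  shows "computes (add_recf f g) xs (a + b)"
proof -
  have "computes (PrimRec (Proj 0) (succ_recf (Proj 1))) [a, b] (a + b)"
    by (induction a)
      (auto intro!: computes.primrec_0 computes.primrec_Suc computes_succ_recf computes_Proj)
  with assms show ?thesis
    unfolding add_recf_def by (blast intro: computes_Comp2)
qed

definition triangle_recf :: "recf \<Rightarrow> recf" where
  "triangle_recf f = Comp (PrimRec Zero (add_recf (Proj 1) (succ_recf (Proj 0)))) [f]"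

lemma computes_triangle_recf:
  assumes "computes f xs a"
  shows "computes (triangle_recf f) xs (triangle a)"
proof -
  have "computes (PrimRec Zero (add_recf (Proj 1) (succ_recf (Proj 0)))) [a] (triangle a)"
  proof (induction a)
    case 0
    show ?case by (auto intro: computes.primrec_0 computes.zero)
  next
    case (Suc a)
    \<comment> \<open>In the recursion step, argument 0 is the counter and argument 1 the previous
      value.\<close>
    have "computes (add_recf (Proj 1) (succ_recf (Proj 0))) [a, triangle a] (triangle a + Suc a)"
      by (intro computes_add_recf computes_succ_recf computes_Proj) auto
    with Suc show ?case by (auto intro: computes.primrec_Suc)
  qed
  with assms show ?thesis
    unfolding triangle_recf_def by (blast intro: computes_Comp1)
qed

definition pair_recf :: "recf \<Rightarrow> recf \<Rightarrow> recf" where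
  "pair_recf f g = add_recf (triangle_recf (add_recf f g)) f"

lemma computes_pair_recf:
  assumes "computes f xs a" "computes g xs b"
  shows "computes (pair_recf f g) xs (prod_encode (a, b))"
  using assms unfolding pair_recf_def prod_encode_def
  by (auto intro: computes_add_recf computes_triangle_recf)

text \<open>Tag 1 marks a function term; the successor and the final 0 come from
  \<open>list_encode [c] = Suc (prod_encode (c, 0))\<close>.\<close>

definition numeral_recf :: "nat \<Rightarrow> nat \<Rightarrow> recf" where
  "numeral_recf z s = PrimRec (const_recf (code_tm (Fun z [])))
     (pair_recf (const_recf 1)
       (pair_recf (const_recf s) (succ_recf (pair_recf (Proj 1) (const_recf 0)))))"

lemma computes_numeral_recf:
  "computes (numeral_recf z s) [n] (code_tm (numeral_tm z s n))"
proof (induction n)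
  case 0
  show ?case
    unfolding numeral_recf_def numeral_tm.simps
    by (intro computes.primrec_0 computes_const_recf)
next
  case (Suc n)
  have "computes (pair_recf (const_recf 1)
      (pair_recf (const_recf s) (succ_recf (pair_recf (Proj 1) (const_recf 0)))))
    [n, code_tm (numeral_tm z s n)] (code_tm (numeral_tm z s (Suc n)))"
    unfolding numeral_tm.simps code_tm.simps list.map list_encode.simps
    by (intro computes_pair_recf computes_const_recf computes_succ_recf computes_Proj) auto
  with Suc show ?case
    unfolding numeral_recf_def by (rule computes.primrec_Suc)
qed

text \<open>For \<open>n = code p\<close> the tested number is the code of
  \<open>All x (Imp (Eq t (Var x)) p)\<close>, with \<open>t\<close> the numeral of
  \<open>n\<close>. As \<open>n\<close> enters undecoded, it need not be a code.\<close>

lemma recursive_set_diagonal: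
  assumes "recursive_set X"
  shows "recursive_set
    {n. prod_encode (4, prod_encode (x, prod_encode (3, prod_encode
          (prod_encode (1, prod_encode (code_tm (numeral_tm z s n), code_tm (Var x))), n)))) \<notin> X}"
    (is "recursive_set {n. ?diag n \<notin> X}")
proof -
  obtain e where e: "\<And>n. computes e [n] (if n \<in> X then 1 else 0)"
    using assms by (auto simp: recursive_set_def)
  define d where "d = pair_recf (const_recf 4) (pair_recf (const_recf x) (pair_recf (const_recf 3)
    (pair_recf (pair_recf (const_recf 1) (pair_recf (numeral_recf z s) (const_recf (code_tm (Var x)))))
      (Proj 0))))"
  have d: "computes d [n] (?diag n)" for n
    unfolding d_def
    by (intro computes_pair_recf computes_const_recf computes_numeral_recf computes_Proj) auto
  \<comment> \<open>Swapping 0 and 1 turns the indicator of \<open>X\<close> into that of its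
    complement.\<close>
  have not_0: "computes (PrimRec (const_recf 1) Zero) [0] 1"
    by (intro computes.primrec_0 computes_const_recf)
  then have not_1: "computes (PrimRec (const_recf 1) Zero) [Suc 0] 0"
    by (blast intro: computes.primrec_Suc computes.zero)
  have "computes (Comp (PrimRec (const_recf 1) Zero) [Comp e [d]]) [n]
      (if n \<in> {n. ?diag n \<notin> X} then 1 else 0)" for n
    using computes_Comp1[OF computes_Comp1[OF d e], of "PrimRec (const_recf 1) Zero"]
      not_0 not_1 by auto
  then show ?thesis
    unfolding recursive_set_def by blast
qed

section \<open>Substitution\<close>

lemma subst_tm_Var_same [simp]: "subst_tm x (Var x) t = t"
  by (induction t) (auto intro: map_idI)

lemma subst_Var_same [simp]: "subst x (Var x) p = p"
  by (induction p) (auto intro: map_idI)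

lemma free_for_Var_same [simp]: "free_for (Var x) x p"
  by (induction p) auto

lemma subst_tm_fresh: "x \<notin> fv_tm u \<Longrightarrow> subst_tm x t u = u"
  by (induction u) (auto intro: map_idI)

lemma subst_fresh: "x \<notin> fv p \<Longrightarrow> subst x t p = p"
  by (induction p) (auto intro: map_idI simp: subst_tm_fresh)

lemma free_for_closed: "fv_tm t = {} \<Longrightarrow> free_for t x p"
  by (induction p) auto

lemma wf_subst_tm: "wf_tm L u \<Longrightarrow> wf_tm L t \<Longrightarrow> wf_tm L (subst_tm x t u)"
  by (induction u) auto

lemma wf_subst: "wf_fm L p \<Longrightarrow> wf_tm L t \<Longrightarrow> wf_fm L (subst x t p)"
  by (induction p) (auto simp: wf_subst_tm)

lemma fv_numeral_tm [simp]: "fv_tm (numeral_tm z s n) = {}"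
  by (induction n) auto

lemma wf_numeral_tm:
  "(z, 0) \<in> fun_syms L \<Longrightarrow> (s, 1) \<in> fun_syms L \<Longrightarrow> wf_tm L (numeral_tm z s n)"
  by (induction n) auto

section \<open>Derivations\<close>

lemma provable_imp_const:
  assumes "wf_fm L p" "wf_fm L q" "provable L T q"
  shows "provable L T (Imp p q)"
  using assms by (blast intro: provable.imp_K provable.mp)

text \<open>Axiom S gives modus ponens under a premise, which replaces the deduction theorem
  here.\<close>

lemma provable_imp_mp:
  assumes "wf_fm L p" "wf_fm L q" "wf_fm L r"
    and "provable L T (Imp p (Imp q r))" "provable L T (Imp p q)"
  shows "provable L T (Imp p r)"
  using assms by (blast intro: provable.imp_S provable.mp)

lemma provable_imp_trans:
  assumes "wf_fm L p" "wf_fm L q" "wf_fm L r"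
    and "provable L T (Imp p q)" "provable L T (Imp q r)"
  shows "provable L T (Imp p r)"
  using assms by - (rule provable_imp_mp[of L p q r], simp_all add: provable_imp_const)

lemma provable_imp_refl:
  assumes "wf_fm L p"
  shows "provable L T (Imp p p)"
  using assms by - (rule provable_imp_mp[of L p "Imp p p" p], simp_all add: provable.imp_K)

text \<open>Under \<open>Neg (Neg p)\<close>, the formula \<open>Neg p\<close> implies both itself
  and its negation, so axiom \<open>neg\<close> gives \<open>p\<close>.\<close>

lemma provable_double_neg:
  assumes "wf_fm L p"
  shows "provable L T (Imp (Neg (Neg p)) p)"
proof -
  have "provable L T (Imp (Neg (Neg p)) (Imp (Neg p) (Neg (Neg p))))"
    using assms by (simp add: provable.imp_K)
  moreover have "provable L T
      (Imp (Imp (Neg p) (Neg (Neg p))) (Imp (Imp (Neg p) (Neg p)) p))"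
    using assms by (simp add: provable.neg)
  ultimately have "provable L T (Imp (Neg (Neg p)) (Imp (Imp (Neg p) (Neg p)) p))"
    using assms by - (rule provable_imp_trans[of L _ "Imp (Neg p) (Neg (Neg p))"], simp_all)
  then show ?thesis
    using assms
    by - (rule provable_imp_mp[of L _ "Imp (Neg p) (Neg p)"],
      simp_all add: provable_imp_const provable_imp_refl)
qed

lemma provable_modus_tollens:
  assumes "wf_fm L p" "wf_fm L q" "provable L T (Imp p q)" "provable L T (Neg q)"
  shows "provable L T (Neg p)"
proof -
  have "provable L T (Imp (Neg (Neg p)) q)"
    using assms by - (rule provable_imp_trans[of L _ p], simp_all add: provable_double_neg)
  moreover have "provable L T (Imp (Neg (Neg p)) (Neg q))"
    using assms by (auto intro: provable_imp_const)
  moreover have "provable L T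
      (Imp (Imp (Neg (Neg p)) (Neg q)) (Imp (Imp (Neg (Neg p)) q) (Neg p)))"
    using assms by (simp add: provable.neg)
  ultimately show ?thesis
    by (blast intro: provable.mp)
qed

text \<open>The equation has \<open>t\<close> on the left so that the equality axiom applies without symmetry.\<close>

definition inst :: "nat \<Rightarrow> tm \<Rightarrow> fm \<Rightarrow> fm" where
  "inst x t p = All x (Imp (Eq t (Var x)) p)"

lemma wf_inst [simp]: "wf_fm L (inst x t p) \<longleftrightarrow> wf_tm L t \<and> wf_fm L p"
  by (simp add: inst_def)

lemma provable_inst:
  assumes "wf_fm L p" "wf_tm L t" "fv_tm t = {}" "provable L T (subst x t p)"
  shows "provable L T (inst x t p)"
proof -
  \<comment> \<open>Taking \<open>Var x\<close> as the second term makes the conclusion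
    \<open>p\<close> itself.\<close>
  have "provable L T (Imp (Eq t (Var x)) (Imp (subst x t p) (subst x (Var x) p)))"
    using assms by (intro provable.eq_subst) (auto simp: free_for_closed)
  then have "provable L T (Imp (Eq t (Var x)) p)"
    using assms
    by - (rule provable_imp_mp[of L _ "subst x t p"], simp_all add: provable_imp_const wf_subst)
  then show ?thesis
    unfolding inst_def by (rule provable.gen)
qed

text \<open>Instantiating the quantifier at \<open>t\<close> turns the guard into
  \<open>Eq t t\<close>, as \<open>t\<close> is closed.\<close>

lemma refutable_inst:
  assumes "wf_fm L p" "wf_tm L t" "fv_tm t = {}" "provable L T (Neg (subst x t p))"
  shows "provable L T (Neg (inst x t p))"
proof -
  have "provable L T (Imp (inst x t p) (subst x t (Imp (Eq t (Var x)) p)))"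
    using assms unfolding inst_def by (intro provable.all_inst free_for_closed) auto
  then have "provable L T (Imp (inst x t p) (Imp (Eq t t) (subst x t p)))"
    using assms by (simp add: subst_tm_fresh)
  then have "provable L T (Imp (inst x t p) (subst x t p))"
    using assms
    by - (rule provable_imp_mp[of L _ "Eq t t"],
      simp_all add: provable_imp_const provable.eq_refl wf_subst)
  with assms show ?thesis
    by - (rule provable_modus_tollens[of L _ "subst x t p"], simp_all add: wf_subst)
qed

text \<open>The diagonal set fixes a variable before the representing formula is known. Renaming
  \<open>x\<close> to \<open>y\<close> directly could cause capture; the guard
  \<open>Eq (Var y) (Var x)\<close> avoids this.\<close>

lemma strongly_representable_in_variable:
  assumes "(z, 0) \<in> fun_syms L" "(s, 1) \<in> fun_syms L" "strongly_representable L z s T A"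
  obtains p where "wf_fm L p" "fv p \<subseteq> {y}"
    and "\<And>n. n \<in> A \<Longrightarrow> provable L T (subst y (numeral_tm z s n) p)"
    and "\<And>n. n \<notin> A \<Longrightarrow> provable L T (Neg (subst y (numeral_tm z s n) p))"
proof -
  obtain x p where p: "wf_fm L p" "fv p \<subseteq> {x}"
    and pos: "\<And>n. n \<in> A \<Longrightarrow> provable L T (subst x (numeral_tm z s n) p)"
    and neg: "\<And>n. n \<notin> A \<Longrightarrow> provable L T (Neg (subst x (numeral_tm z s n) p))"
    using assms(3) unfolding strongly_representable_def by blast
  show ?thesis
  proof (cases "x = y")
    case True
    with p pos neg that show ?thesis by blast
  next
    case False
    \<comment> \<open>Since \<open>y\<close> is not free in \<open>p\<close>, only the guard
      changes.\<close>
    have subst: "subst y t (inst x (Var y) p) = inst x t p" for t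
      using False subst_fresh[of y p t] p(2) by (auto simp: inst_def)
    show ?thesis
    proof (rule that[of "inst x (Var y) p"])
      show "fv (inst x (Var y) p) \<subseteq> {y}"
        using p(2) by (auto simp: inst_def)
    qed (use p pos neg assms in
        \<open>simp_all add: subst provable_inst refutable_inst wf_numeral_tm\<close>)
  qed
qed

section \<open>The diagonal contradiction\<close>

theorem theorem5p3:
  fixes L :: language and z s :: nat and T :: "fm set"
  assumes "(z, 0) \<in> fun_syms L" and "(s, 1) \<in> fun_syms L"
    and "re_theory L T" and "consistent L T"
    and "RSS L z s T"
  shows "RI L T"
  unfolding RI_def
proof
  assume "\<exists>X. recursive_set X \<and> provable_codes L T \<subseteq> X \<and> X \<inter> refutable_codes L T = {}"
  then obtain X where X: "recursive_set X" "provable_codes L T \<subseteq> X"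
    "X \<inter> refutable_codes L T = {}"
    by blast
  define D where "D = {n. prod_encode (4, prod_encode (0, prod_encode (3, prod_encode
    (prod_encode (1, prod_encode (code_tm (numeral_tm z s n), code_tm (Var 0))), n)))) \<notin> X}"
  have "strongly_representable L z s T D"
    using assms(5) recursive_set_diagonal[OF X(1)] unfolding RSS_def D_def by blast
  then obtain p where p: "wf_fm L p" "fv p \<subseteq> {0}"
    and pos: "\<And>n. n \<in> D \<Longrightarrow> provable L T (subst 0 (numeral_tm z s n) p)"
    and neg: "\<And>n. n \<notin> D \<Longrightarrow> provable L T (Neg (subst 0 (numeral_tm z s n) p))"
    using strongly_representable_in_variable[OF assms(1,2)] by metis
  define t where "t = numeral_tm z s (code p)"
  have t: "wf_tm L t" "fv_tm t = {}"
    using assms(1,2) by (simp_all add: t_def wf_numeral_tm)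
  have sentence: "sentence L (inst 0 t p)"
    using p t unfolding sentence_def by (auto simp: inst_def)
  \<comment> \<open>Since \<open>t\<close> is the numeral of \<open>code p\<close>, the number
    tested in \<open>D\<close> at \<open>code p\<close> is the code of this very sentence.\<close>
  have D_iff: "code p \<in> D \<longleftrightarrow> code (inst 0 t p) \<notin> X"
    by (simp add: D_def inst_def t_def)
  show False
  proof (cases "code p \<in> D")
    case True
    then have "provable L T (inst 0 t p)"
      using pos p t by (auto intro: provable_inst simp: t_def)
    with sentence X(2) have "code (inst 0 t p) \<in> X"
      by (auto simp: provable_codes_def)
    with True D_iff show False by blast
  next
    case False
    then have "provable L T (Neg (inst 0 t p))"
      using neg p t by (auto intro: refutable_inst simp: t_def)
    with sentence have "code (inst 0 t p) \<in> refutable_codes L T"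
      by (auto simp: refutable_codes_def)
    with False D_iff X(3) show False by blast
  qed
qed

end
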